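(* Let $1<p<\infty$, let $N\ge 1$, and let $D$ be one of $\mathbb{R}^d$, $\mathbb{R}^m\times\mathbb{R}^n$, $\mathbb{T}^d$, $\mathbb{T}^m\times\mathbb{T}^n$. Let $W=(w_{ij})_{i,j=1}^N\colon D\to\mathbb{C}^{N\times N}$ be a measurable matrix-valued function which is positive definite a.e., let $w\colon D\to\mathbb{C}$ be a scalar weight, and let $r\colon D\to\mathbb{C}^N$ be a measurable function whose values are unit vectors. Then the projection in the direction of $r$, $P_r\colon L^p(W)\to L^p(w)$, given by $P_r(f)=\langle f,r\rangle$ (pointwise inner product), is bounded if and only if $$w^{1/p}\,\|W^{-1/p}r\|\in L^\infty(D).$$ In particular: (a) Writing $W^{s}=(w_{ij}^{(s)})_{i,j=1}^N$ for the entries of the power $W^s$, $s\in\mathbb{R}$, and $e_k$ for the $k$-th standard basis vector of $\mathbb{C}^N$, the projection $P_k=P_{e_k}\colon L^p(W)\to L^p(w_{kk})$ is bounded if and only if $$w_{kk}^{2/p}\; w_{kk}^{(-2/p)}\in L^\infty(D).$$ (b) If $\lambda_i\colon D\to\mathbb{R}$ and $v_i\colon D\to\mathbb{C}^N$ are measurable functions which are, respectively, an eigenvalue and a corresponding unit eigenvector of $W$ (pointwise a.e.), then the projection $P_{v_i}\colon L^p(W)\to L^p(\lambda_i)$ is always bounded.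
   Context: $\mathbb{T}^d$ is the $d$-dimensional torus; $D$ carries its standard (Lebesgue) measure $\mu$. A scalar weight is a measurable function $w$ on $D$ that is positive a.e. For a scalar weight $w$, $L^p(w)$ is the space of measurable $f\colon D\to\mathbb{C}$ with $\|f\|_{L^p(w)}=\left(\int_D|f|^p w\,d\mu\right)^{1/p}<\infty$. For a measurable, a.e. positive definite $W\colon D\to\mathbb{C}^{N\times N}$, $L^p(W)$ is the space of measurable $f\colon D\to\mathbb{C}^N$ with $\|f\|_{L^p(W)}=\left(\int_D |W^{1/p}f|^p\,d\mu\right)^{1/p}<\infty$, where $|\cdot|=\|\cdot\|$ is the Euclidean norm on $\mathbb{C}^N$. In both cases functions with zero norm are identified with $0$. Powers $W^s$ ($s\in\mathbb{R}$) are defined pointwise by the functional calculus for positive definite matrices. Thus $w_{kk}^{2/p}$ is the power $2/p$ of the diagonal entry $w_{kk}$ of $W$, while $w_{kk}^{(-2/p)}$ is the $k$-th diagonal entry of $W^{-2/p}$. Boundedness of $P_r\colon L^p(W)\to L^p(w)$ means there is a constant $C<\infty$ with $\|P_r f\|_{L^p(w)}\le C\|f\|_{L^p(W)}$ for all $f\in L^p(W)$. *)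

theory Defs
  imports "HOL-Analysis.Analysis"
begin

text \<open>The torus is represented by its fundamental domain, the half-open unit cube, with Lebesgue
  measure. For \<open>'a = real ^ 'd\<close> this is the \<open>d\<close>-dimensional torus; for
  \<open>'a = (real ^ 'm) \<times> (real ^ 'n)\<close> it is the product of an \<open>m\<close>- and an \<open>n\<close>-dimensional one, since
  the basis of a product space is the union of the bases of the factors. In the same way
  \<open>lebesgue\<close> covers both \<open>real ^ 'd\<close> and \<open>(real ^ 'm) \<times> (real ^ 'n)\<close>.\<close>

definition torus :: "'a::euclidean_space measure" where
  "torus = lebesgue_on {x. \<forall>b\<in>Basis. 0 \<le> x \<bullet> b \<and> x \<bullet> b < 1}"

text \<open>The library's \<open>\<bullet>\<close> on \<open>complex ^ 'n\<close> is the real part of the following inner product;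
  the library's \<open>norm\<close> is the Euclidean norm it induces.\<close>

definition cinner :: "complex ^ 'n \<Rightarrow> complex ^ 'n \<Rightarrow> complex" where
  "cinner x y = (\<Sum>i\<in>UNIV. x $ i * cnj (y $ i))"

definition conj_transpose :: "complex ^ 'n ^ 'm \<Rightarrow> complex ^ 'm ^ 'n" where
  "conj_transpose A = (\<chi> i j. cnj (A $ j $ i))"

definition pos_definite :: "complex ^ 'n ^ 'n \<Rightarrow> bool" where
  "pos_definite A \<longleftrightarrow> conj_transpose A = A \<and> (\<forall>x. x \<noteq> 0 \<longrightarrow> 0 < Re (cinner (A *v x) x))"

definition unitary_matrix :: "complex ^ 'n ^ 'n \<Rightarrow> bool" where
  "unitary_matrix U \<longleftrightarrow> conj_transpose U ** U = mat 1 \<and> U ** conj_transpose U = mat 1"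

definition real_diag :: "('n \<Rightarrow> real) \<Rightarrow> complex ^ 'n ^ 'n" where
  "real_diag d = (\<chi> i j. if i = j then complex_of_real (d i) else 0)"

text \<open>Functional calculus for Hermitian matrices: \<open>U diag(d) U* \<mapsto> U diag(g d) U*\<close>. The result does
  not depend on the diagonalization chosen; for matrices that are not Hermitian it is unspecified.\<close>

definition fun_calculus :: "(real \<Rightarrow> real) \<Rightarrow> complex ^ 'n ^ 'n \<Rightarrow> complex ^ 'n ^ 'n" where
  "fun_calculus g A = (THE B. \<exists>U d. unitary_matrix U
      \<and> A = U ** real_diag d ** conj_transpose U
      \<and> B = U ** real_diag (\<lambda>i. g (d i)) ** conj_transpose U)"

definition matrix_pow :: "complex ^ 'n ^ 'n \<Rightarrow> real \<Rightarrow> complex ^ 'n ^ 'n" where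
  "matrix_pow A s = fun_calculus (\<lambda>t. t powr s) A"

text \<open>Weights are complex valued functions that are real and positive almost everywhere, so that
  the diagonal entries of a matrix weight are literally weights.\<close>

definition scalar_weight :: "'a measure \<Rightarrow> ('a \<Rightarrow> complex) \<Rightarrow> bool" where
  "scalar_weight D w \<longleftrightarrow>
     w \<in> borel_measurable D \<and> (AE x in D. Im (w x) = 0 \<and> 0 < Re (w x))"

definition matrix_weight :: "'a measure \<Rightarrow> ('a \<Rightarrow> complex ^ 'n ^ 'n) \<Rightarrow> bool" where
  "matrix_weight D W \<longleftrightarrow> W \<in> borel_measurable D \<and> (AE x in D. pos_definite (W x))"

text \<open>The weighted spaces consist of functions, not of classes modulo functions of zero norm.
  The norms are meaningful on the respective spaces only, as the Bochner integral of a
  non-integrable function is \<open>0\<close>.\<close>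

definition scalar_Lp :: "'a measure \<Rightarrow> real \<Rightarrow> ('a \<Rightarrow> complex) \<Rightarrow> ('a \<Rightarrow> complex) set" where
  "scalar_Lp D p w =
     {f \<in> borel_measurable D. integrable D (\<lambda>x. norm (f x) powr p * Re (w x))}"

definition scalar_Lp_norm :: "'a measure \<Rightarrow> real \<Rightarrow> ('a \<Rightarrow> complex) \<Rightarrow> ('a \<Rightarrow> complex) \<Rightarrow> real" where
  "scalar_Lp_norm D p w f = (\<integral>x. norm (f x) powr p * Re (w x) \<partial>D) powr (1 / p)"

definition matrix_Lp ::
  "'a measure \<Rightarrow> real \<Rightarrow> ('a \<Rightarrow> complex ^ 'n ^ 'n) \<Rightarrow> ('a \<Rightarrow> complex ^ 'n) set" where
  "matrix_Lp D p W =
     {f \<in> borel_measurable D. integrable D (\<lambda>x. norm (matrix_pow (W x) (1 / p) *v f x) powr p)}"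

definition matrix_Lp_norm ::
  "'a measure \<Rightarrow> real \<Rightarrow> ('a \<Rightarrow> complex ^ 'n ^ 'n) \<Rightarrow> ('a \<Rightarrow> complex ^ 'n) \<Rightarrow> real" where
  "matrix_Lp_norm D p W f =
     (\<integral>x. norm (matrix_pow (W x) (1 / p) *v f x) powr p \<partial>D) powr (1 / p)"

definition Linfty :: "'a measure \<Rightarrow> ('a \<Rightarrow> complex) set" where
  "Linfty D = {f \<in> borel_measurable D. \<exists>C::real. AE x in D. norm (f x) \<le> C}"

definition proj :: "('a \<Rightarrow> complex ^ 'n) \<Rightarrow> ('a \<Rightarrow> complex ^ 'n) \<Rightarrow> 'a \<Rightarrow> complex" where
  "proj r f = (\<lambda>x. cinner (f x) (r x))"

definition bounded_Lp :: "'a measure \<Rightarrow> real \<Rightarrow> ('a \<Rightarrow> complex ^ 'n ^ 'n) \<Rightarrow> ('a \<Rightarrow> complex) \<Rightarrow>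
    (('a \<Rightarrow> complex ^ 'n) \<Rightarrow> 'a \<Rightarrow> complex) \<Rightarrow> bool" where
  "bounded_Lp D p W w T \<longleftrightarrow> (\<exists>C::real. \<forall>f \<in> matrix_Lp D p W.
     T f \<in> scalar_Lp D p w \<and> scalar_Lp_norm D p w (T f) \<le> C * matrix_Lp_norm D p W f)"

end

theory Submission
  imports Defs
begin

text \<open>Since \<open>W\<^bsup>1/p\<^esup>\<close> is Hermitian, \<open>\<langle>f, r\<rangle> = \<langle>W\<^bsup>1/p\<^esup> f, W\<^bsup>-1/p\<^esup> r\<rangle>\<close>, so Cauchy-Schwarz bounds the projection
  pointwise by \<open>|W\<^bsup>1/p\<^esup> f| |W\<^bsup>-1/p\<^esup> r|\<close>. Equality holds when \<open>f\<close> is a multiple of \<open>W\<^bsup>-2/p\<^esup> r\<close>; testing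
  the operator on such functions supported on sets of finite measure gives the converse. Part (a)
  is the identity \<open>|W\<^bsup>-1/p\<^esup> e\<^sub>k|\<^sup>2 = \<langle>W\<^bsup>-2/p\<^esup> e\<^sub>k, e\<^sub>k\<rangle>\<close>, and in part (b) the weighted norm is identically \<open>1\<close>.\<close>

subsection \<open>Powers of positive definite matrices\<close>

lemma inner_eq_Re_cinner: "x \<bullet> y = Re (cinner x y)"
  by (simp add: cinner_def inner_vec_def inner_complex_def)

lemma cinner_commute: "cinner y x = cnj (cinner x y)"
  by (simp add: cinner_def mult.commute)

lemma cinner_self: "cinner x x = complex_of_real ((norm x)\<^sup>2)"
proof (rule complex_eqI)
  show "Re (cinner x x) = Re (complex_of_real ((norm x)\<^sup>2))"
    by (simp add: inner_eq_Re_cinner[symmetric] dot_square_norm)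
  show "Im (cinner x x) = Im (complex_of_real ((norm x)\<^sup>2))"
    by (simp add: cinner_def)
qed

lemma cinner_scaleR_left: "cinner (a *\<^sub>R x) y = complex_of_real a * cinner x y"
  unfolding cinner_def vector_scaleR_component by (simp add: scaleR_conv_of_real sum_distrib_left mult.assoc)

lemma cinner_scale_right: "cinner x (a *s y) = cnj a * cinner x y"
  by (simp add: cinner_def sum_distrib_left mult.assoc mult.left_commute)

lemma scaleR_eq_vector_scalar_mult: "a *\<^sub>R x = complex_of_real a *s x"
  unfolding vec_eq_iff vector_scaleR_component by (simp add: scaleR_conv_of_real)

lemma complex_matrix_vector_mult_scaleR:
  fixes A :: "complex ^ 'n ^ 'm"
  shows "A *v (a *\<^sub>R x) = a *\<^sub>R (A *v x)"
  by (rule linear_scale) (rule matrix_vector_mul_linear)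

lemma norm_cinner_le: "norm (cinner x y) \<le> norm x * norm y"
proof -
  have "norm (cinner x y) \<le> (\<Sum>i\<in>UNIV. \<bar>norm (x $ i)\<bar> * \<bar>norm (y $ i)\<bar>)"
    unfolding cinner_def by (rule order_trans[OF norm_sum]) (simp add: norm_mult)
  also have "\<dots> \<le> norm x * norm y"
    unfolding norm_vec_def by (rule L2_set_mult_ineq)
  finally show ?thesis .
qed

lemma cinner_matrix_left: "cinner (A *v x) y = cinner x (conj_transpose A *v y)"
proof -
  have "cinner (A *v x) y = (\<Sum>i\<in>UNIV. \<Sum>j\<in>UNIV. A $ i $ j * x $ j * cnj (y $ i))"
    by (simp add: cinner_def matrix_vector_mult_def sum_distrib_right)
  also have "\<dots> = (\<Sum>j\<in>UNIV. \<Sum>i\<in>UNIV. A $ i $ j * x $ j * cnj (y $ i))"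
    by (rule sum.swap)
  also have "\<dots> = cinner x (conj_transpose A *v y)"
    by (simp add: cinner_def matrix_vector_mult_def conj_transpose_def sum_distrib_left mult_ac)
  finally show ?thesis .
qed

lemma cinner_axis_axis: "cinner (A *v axis k 1) (axis k 1) = A $ k $ k"
  by (simp add: cinner_def axis_def matrix_vector_mult_def if_distrib cong: if_cong)

section \<open>Algebra of adjoints and real diagonal matrices\<close>

lemma conj_transpose_mult:
  "conj_transpose (A ** B) = conj_transpose B ** conj_transpose A"
  by (simp add: conj_transpose_def matrix_matrix_mult_def vec_eq_iff mult.commute)

lemma conj_transpose_conj_transpose [simp]: "conj_transpose (conj_transpose A) = A"
  by (simp add: conj_transpose_def vec_eq_iff)

lemma conj_transpose_real_diag [simp]: "conj_transpose (real_diag d) = real_diag d"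
  by (simp add: conj_transpose_def real_diag_def vec_eq_iff)

lemma real_diag_mult: "real_diag d ** real_diag e = real_diag (\<lambda>i. d i * e i)"
proof -
  have "(\<Sum>k\<in>UNIV. (if i = k then complex_of_real (d i) else 0) * (if k = j then complex_of_real (e k) else 0))
     = (if i = j then complex_of_real (d i * e i) else 0)" for i j
  proof -
    have "(\<Sum>k\<in>UNIV. (if i = k then complex_of_real (d i) else 0) * (if k = j then complex_of_real (e k) else 0))
      = (\<Sum>k\<in>UNIV. if i = k then (if k = j then complex_of_real (d i) * complex_of_real (e k) else 0) else 0)"
      by (intro sum.cong) auto
    then show ?thesis by auto
  qed
  then show ?thesis
    by (simp add: real_diag_def matrix_matrix_mult_def vec_eq_iff)
qed

lemma mult_real_diag_nth: "(A ** real_diag d) $ i $ j = A $ i $ j * complex_of_real (d j)"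
  by (simp add: matrix_matrix_mult_def real_diag_def if_distrib cong: if_cong)

lemma real_diag_mult_nth: "(real_diag d ** A) $ i $ j = complex_of_real (d i) * A $ i $ j"
proof -
  have "(real_diag d ** A) $ i $ j
      = (\<Sum>k\<in>UNIV. if i = k then complex_of_real (d i) * A $ k $ j else 0)"
    unfolding matrix_matrix_mult_def real_diag_def vec_lambda_beta by (intro sum.cong) auto
  then show ?thesis by simp
qed

lemma real_diag_vector_nth: "(real_diag d *v x) $ i = complex_of_real (d i) * x $ i"
proof -
  have "(real_diag d *v x) $ i = (\<Sum>k\<in>UNIV. if i = k then complex_of_real (d i) * x $ k else 0)"
    unfolding matrix_vector_mult_def real_diag_def vec_lambda_beta by (intro sum.cong) auto
  then show ?thesis by simp
qed

lemma real_diag_1: "real_diag (\<lambda>i. 1) = mat 1"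
  by (simp add: real_diag_def mat_def vec_eq_iff)

section \<open>Spectral theorem for Hermitian matrices\<close>

text \<open>A maximizer of the quadratic form on the unit sphere of an invariant subspace is an
  eigenvector: the defect \<open>l |y|\<^sup>2 - \<langle>Ay, y\<rangle>\<close> is nonnegative and vanishes there, so it is
  critical there.\<close>

lemma hermitian_eigenvector_in_subspace:
  fixes A :: "complex ^ 'n ^ 'n"
  assumes A: "conj_transpose A = A"
    and V: "subspace V" "closed V" "\<And>x. x \<in> V \<Longrightarrow> A *v x \<in> V"
    and z: "z \<in> V" "z \<noteq> 0"
  obtains x l where "x \<in> V" "norm x = 1" "A *v x = l *\<^sub>R x"
proof -
  let ?S = "V \<inter> sphere 0 1"
  have cont: "continuous_on UNIV (\<lambda>x. A *v x)"
    by (rule linear_continuous_on) (rule matrix_vector_mul_bounded_linear)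
  have "compact ?S"
    using V(2) by (intro closed_Int_compact compact_sphere)
  moreover have "(1 / norm z) *\<^sub>R z \<in> ?S"
    using V(1) z by (auto simp: subspace_scale)
  moreover have "continuous_on ?S (\<lambda>x. (A *v x) \<bullet> x)"
    by (intro continuous_on_inner continuous_on_subset[OF cont] continuous_on_id subset_UNIV)
  ultimately have "\<exists>x\<in>?S. \<forall>y\<in>?S. (A *v y) \<bullet> y \<le> (A *v x) \<bullet> x"
    by (intro continuous_attains_sup) auto
  then obtain x where x: "x \<in> ?S" and mx: "\<And>y. y \<in> ?S \<Longrightarrow> (A *v y) \<bullet> y \<le> (A *v x) \<bullet> x"
    by blast
  define l where "l = (A *v x) \<bullet> x"
  have xV: "x \<in> V" and nx: "norm x = 1" using x by auto
  have sym: "(A *v y) \<bullet> u = y \<bullet> (A *v u)" for y u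
    by (simp add: inner_eq_Re_cinner cinner_matrix_left A)
  \<comment> \<open>Both sides scale quadratically, so the maximum over the unit sphere controls all
    of \<open>V\<close>.\<close>
  have bound: "(A *v y) \<bullet> y \<le> l * (y \<bullet> y)" if "y \<in> V" for y
  proof (cases "y = 0")
    case False
    let ?u = "(1 / norm y) *\<^sub>R y"
    have "?u \<in> ?S" using False V(1) that by (auto simp: subspace_scale)
    from mx[OF this] have "(1 / norm y) * ((1 / norm y) * ((A *v y) \<bullet> y)) \<le> l"
      by (simp add: complex_matrix_vector_mult_scaleR l_def)
    moreover have "(norm y)\<^sup>2 > 0" using False by simp
    ultimately have "(A *v y) \<bullet> y \<le> l * (norm y)\<^sup>2"
      by (simp add: field_simps power2_eq_square)
    then show ?thesis by (simp add: dot_square_norm)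
  qed simp
  \<comment> \<open>Up to the factor 2, \<open>y\<close> is the gradient of the defect at
    \<open>x\<close>. Since \<open>V\<close> is invariant, moving from \<open>x\<close> along
    \<open>y\<close> stays inside \<open>V\<close>.\<close>
  define y where "y = l *\<^sub>R x - A *v x"
  have yV: "y \<in> V" unfolding y_def using V xV by (simp add: subspace_diff subspace_scale)
  \<comment> \<open>This is the defect at \<open>x + t y\<close>, expanded in \<open>t\<close>. Its
    constant term vanishes by the choice of \<open>l\<close>.\<close>
  have quad: "0 \<le> 2 * t * (y \<bullet> y) + t\<^sup>2 * (l * (y \<bullet> y) - (A *v y) \<bullet> y)" for t
  proof -
    have "x + t *\<^sub>R y \<in> V" using V(1) xV yV by (simp add: subspace_add subspace_scale)
    from bound[OF this] have "(A *v x) \<bullet> x + t * ((A *v x) \<bullet> y) + t * ((A *v y) \<bullet> x) + t\<^sup>2 * ((A *v y) \<bullet> y)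
       \<le> l * (x \<bullet> x + 2 * t * (x \<bullet> y) + t\<^sup>2 * (y \<bullet> y))"
      by (simp add: complex_matrix_vector_mult_scaleR matrix_vector_right_distrib inner_add_left inner_add_right
          inner_commute power2_eq_square algebra_simps)
    moreover have "(A *v y) \<bullet> x = (A *v x) \<bullet> y" by (metis sym inner_commute)
    moreover have "x \<bullet> x = 1" using nx by (simp add: dot_square_norm)
    moreover have "2 * t * (y \<bullet> y) = 2 * t * (l * (x \<bullet> y)) - 2 * t * ((A *v x) \<bullet> y)"
      by (subst y_def) (simp add: inner_diff_left algebra_simps)
    ultimately show ?thesis by (simp add: l_def[symmetric] algebra_simps)
  qed
  have "y \<bullet> y = 0"
  proof (rule ccontr)
    assume "y \<bullet> y \<noteq> 0"
    then have p: "y \<bullet> y > 0" by (metis inner_ge_zero less_eq_real_def)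
    define c where "c = l * (y \<bullet> y) - (A *v y) \<bullet> y"
    have c: "c \<ge> 0" using bound[OF yV] by (simp add: c_def)
    \<comment> \<open>A small negative \<open>t\<close> makes the linear term win over the quadratic
      one. The denominator is \<open>c + 1\<close> because \<open>c\<close> may be zero.\<close>
    define t where "t = - (y \<bullet> y) / (c + 1)"
    have t: "t < 0" using p c by (simp add: t_def divide_neg_pos)
    have tc: "t * (c + 1) = - (y \<bullet> y)" using c by (simp add: t_def)
    have "2 * t * (y \<bullet> y) + t\<^sup>2 * c = t * ((y \<bullet> y) + (t * (c + 1) + y \<bullet> y) - t)"
      by (simp add: power2_eq_square algebra_simps)
    also have "\<dots> = t * (y \<bullet> y - t)" by (simp add: tc)
    also have "\<dots> < 0" using t p by (intro mult_neg_pos) linarith+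
    finally show False using quad[of t] by (simp add: c_def)
  qed
  then have "A *v x = l *\<^sub>R x" by (simp add: y_def)
  with xV nx show ?thesis by (rule that)
qed

text \<open>The vectors are found one at a time. The orthogonal complement of the eigenvectors
  already chosen is invariant because \<open>A\<close> is Hermitian, so it contains a further
  eigenvector as long as it is nonzero. Indexing by subsets of \<open>'n\<close> makes
  \<open>I = UNIV\<close> yield the columns of a square matrix.\<close>

lemma hermitian_orthonormal_eigenvectors:
  fixes A :: "complex ^ 'n ^ 'n" and I :: "'n set"
  assumes A: "conj_transpose A = A"
  shows "\<exists>v d. (\<forall>i\<in>I. A *v v i = d i *\<^sub>R v i) \<and>
    (\<forall>i\<in>I. \<forall>j\<in>I. cinner (v i) (v j) = (if i = j then 1 else 0))"
  using finite[of I]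
proof (induction I rule: finite_induct)
  case (insert i I)
  then obtain v :: "'n \<Rightarrow> complex ^ 'n" and d
    where v: "\<And>i. i \<in> I \<Longrightarrow> A *v v i = d i *\<^sub>R v i"
      and o: "\<And>i j. i \<in> I \<Longrightarrow> j \<in> I \<Longrightarrow> cinner (v i) (v j) = (if i = j then 1 else 0)"
    by metis
  let ?V = "{x. \<forall>j\<in>I. cinner x (v j) = 0}"
  \<comment> \<open>\<open>dim\<close> and \<open>orthogonal\<close> are real notions. Being
    real-orthogonal to both \<open>v j\<close> and \<open>\<i> *s v j\<close> amounts to complex
    orthogonality, and the at most \<open>2 * card I\<close> vectors of \<open>?T\<close> cannot
    span a space of real dimension \<open>2 * CARD('n)\<close>.\<close>
  let ?T = "v ` I \<union> (\<lambda>j. \<i> *s v j) ` I"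
  have "card I < CARD('n)"
    using insert.hyps by (metis finite_code psubset_card_mono UNIV_I psubsetI subset_UNIV)
  moreover have "dim ?T \<le> card ?T" by (rule dim_le_card') simp
  moreover have "card ?T \<le> card I + card I"
    by (rule order_trans[OF card_Un_le]) (intro add_mono card_image_le finite)
  ultimately have "dim ?T < DIM(complex ^ 'n)" by simp
  then obtain z where z: "z \<noteq> 0" "\<And>y. y \<in> span ?T \<Longrightarrow> orthogonal z y"
    by (rule orthogonal_to_subspace_exists) blast
  have zV: "z \<in> ?V"
  proof (intro CollectI ballI complex_eqI)
    fix j assume j: "j \<in> I"
    show "Re (cinner z (v j)) = Re 0"
      using z(2)[of "v j"] j by (simp add: span_base orthogonal_def inner_eq_Re_cinner)
    have "orthogonal z (\<i> *s v j)" using j by (intro z(2) span_base) auto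
    then show "Im (cinner z (v j)) = Im 0"
      by (simp add: orthogonal_def inner_eq_Re_cinner cinner_scale_right)
  qed
  have sub: "subspace ?V"
    by (auto simp: subspace_def cinner_scaleR_left)
       (simp add: cinner_def distrib_right sum.distrib)+
  have clo: "closed ?V"
    by (rule closed_subspace[OF sub])
  have inv: "A *v x \<in> ?V" if "x \<in> ?V" for x
  proof (intro CollectI ballI)
    fix j assume j: "j \<in> I"
    have "cinner (A *v x) (v j) = cinner x (complex_of_real (d j) *s v j)"
      by (simp add: cinner_matrix_left A v[OF j] scaleR_eq_vector_scalar_mult)
    then show "cinner (A *v x) (v j) = 0"
      using that j by (simp add: cinner_scale_right)
  qed
  obtain x l where x: "x \<in> ?V" "norm x = 1" "A *v x = l *\<^sub>R x"
    by (rule hermitian_eigenvector_in_subspace[OF A sub clo inv zV z(1)])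
  have xv: "cinner x (v j) = 0" "cinner (v j) x = 0" if "j \<in> I" for j
    using x(1) that cinner_commute[of "v j" x] by auto
  have "cinner x x = 1" using x(2) by (simp add: cinner_self)
  then show ?case
    using insert.hyps x(3) xv v o
    by (intro exI[of _ "v(i := x)"] exI[of _ "d(i := l)"]) auto
qed simp

text \<open>The orthonormal eigenvectors become the columns of \<open>U\<close>: orthonormality says
  that \<open>U\<close> is unitary, and the eigenvalue equations say
  \<open>A ** U = U ** real_diag d\<close>.\<close>

lemma hermitian_diagonalization:
  fixes A :: "complex ^ 'n ^ 'n"
  assumes "conj_transpose A = A"
  obtains U d where "unitary_matrix U" "A = U ** real_diag d ** conj_transpose U"
proof -
  obtain v :: "'n \<Rightarrow> complex ^ 'n" and d where v: "\<And>i. A *v v i = d i *\<^sub>R v i"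
    and o: "\<And>i j. cinner (v i) (v j) = (if i = j then 1 else 0)"
    using hermitian_orthonormal_eigenvectors[OF assms, of UNIV] by (metis UNIV_I)
  define U :: "complex ^ 'n ^ 'n" where "U = (\<chi> i j. v j $ i)"
  have "(conj_transpose U ** U) $ i $ j = cinner (v j) (v i)" for i j
    by (simp add: U_def conj_transpose_def matrix_matrix_mult_def cinner_def mult.commute)
  then have 1: "conj_transpose U ** U = mat 1"
    by (simp add: o mat_def vec_eq_iff eq_commute)
  then have 2: "U ** conj_transpose U = mat 1"
    by (simp add: matrix_left_right_inverse)
  have "(A ** U) $ i $ j = (U ** real_diag d) $ i $ j" for i j
  proof -
    have "(A ** U) $ i $ j = (A *v v j) $ i"
      by (simp add: U_def matrix_matrix_mult_def matrix_vector_mult_def)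
    then show ?thesis
      by (simp add: v mult_real_diag_nth U_def scaleR_eq_vector_scalar_mult mult.commute)
  qed
  then have "A ** U = U ** real_diag d" by (simp add: vec_eq_iff)
  then have "A = U ** real_diag d ** conj_transpose U"
    by (metis 2 matrix_mul_assoc matrix_mul_rid)
  with 1 2 show ?thesis by (intro that) (auto simp: unitary_matrix_def)
qed

section \<open>Functional calculus and powers\<close>

text \<open>This justifies the definite description in \<open>fun_calculus\<close>. Two
  diagonalizations of one matrix differ by a unitary that intertwines the diagonal parts, and it
  still intertwines them after \<open>g\<close> is applied.\<close>

lemma fun_calculus_diagonalization:
  fixes U :: "complex ^ 'n ^ 'n"
  assumes U: "unitary_matrix U"
  shows "fun_calculus g (U ** real_diag d ** conj_transpose U)
    = U ** real_diag (\<lambda>i. g (d i)) ** conj_transpose U"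
  unfolding fun_calculus_def
proof (rule the_equality)
  show "\<exists>V e. unitary_matrix V
      \<and> U ** real_diag d ** conj_transpose U = V ** real_diag e ** conj_transpose V
      \<and> U ** real_diag (\<lambda>i. g (d i)) ** conj_transpose U
        = V ** real_diag (\<lambda>i. g (e i)) ** conj_transpose V"
    using U by blast
next
  fix B
  assume "\<exists>V e. unitary_matrix V
      \<and> U ** real_diag d ** conj_transpose U = V ** real_diag e ** conj_transpose V
      \<and> B = V ** real_diag (\<lambda>i. g (e i)) ** conj_transpose V"
  then obtain V e where V: "unitary_matrix V"
    and eq: "U ** real_diag d ** conj_transpose U = V ** real_diag e ** conj_transpose V"
    and B: "B = V ** real_diag (\<lambda>i. g (e i)) ** conj_transpose V"
    by blast
  define M where "M = conj_transpose V ** U"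
  have "M ** real_diag d = conj_transpose V ** (U ** real_diag d ** conj_transpose U) ** U"
    using U by (simp add: M_def unitary_matrix_def matrix_mul_assoc[symmetric])
  also have "\<dots> = real_diag e ** M"
    using V by (simp add: eq M_def unitary_matrix_def matrix_mul_assoc)
  finally have "M $ i $ j * complex_of_real (d j) = complex_of_real (e i) * M $ i $ j" for i j
    by (metis mult_real_diag_nth real_diag_mult_nth)
  \<comment> \<open>A nonzero entry of \<open>M\<close> forces \<open>d j = e i\<close>, hence
    \<open>g (d j) = g (e i)\<close>; a zero entry makes both sides vanish.\<close>
  then have "M $ i $ j * complex_of_real (g (d j)) = complex_of_real (g (e i)) * M $ i $ j" for i j
    by (cases "M $ i $ j = 0") (metis mult_zero_left mult_zero_right,
        metis mult.commute mult_cancel_right of_real_eq_iff)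
  then have "M ** real_diag (\<lambda>i. g (d i)) = real_diag (\<lambda>i. g (e i)) ** M"
    by (simp add: vec_eq_iff mult_real_diag_nth real_diag_mult_nth)
  then have "V ** (M ** real_diag (\<lambda>i. g (d i))) ** conj_transpose U
      = V ** (real_diag (\<lambda>i. g (e i)) ** M) ** conj_transpose U"
    by simp
  moreover have "V ** (M ** X) = U ** X" for X
    using V by (simp add: M_def unitary_matrix_def matrix_mul_assoc)
  moreover have "(X ** M) ** conj_transpose U = X ** conj_transpose V" for X
    using U by (simp add: M_def unitary_matrix_def matrix_mul_assoc[symmetric])
  ultimately show "B = U ** real_diag (\<lambda>i. g (d i)) ** conj_transpose U"
    unfolding B by (metis matrix_mul_assoc)
qed

text \<open>One diagonalization serves all exponents \<open>s\<close> at once, which reduces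
  identities between powers to identities between positive reals.\<close>

lemma pos_definite_diagonalization:
  fixes A :: "complex ^ 'n ^ 'n"
  assumes A: "pos_definite A"
  obtains U d where "unitary_matrix U" "\<And>i. 0 < d i" "A = U ** real_diag d ** conj_transpose U"
    "\<And>s. matrix_pow A s = U ** real_diag (\<lambda>i. d i powr s) ** conj_transpose U"
proof -
  obtain U d where U: "unitary_matrix U" and Ad: "A = U ** real_diag d ** conj_transpose U"
    using A hermitian_diagonalization unfolding pos_definite_def by metis
  have pos: "0 < d i" for i
  proof -
    \<comment> \<open>This is the \<open>i\<close>-th column of \<open>U\<close>, an eigenvector for
      \<open>d i\<close>; the quadratic form there equals \<open>d i\<close>.\<close>
    let ?u = "U *v axis i 1"
    have e: "conj_transpose U *v ?u = axis i 1"
      using U by (simp add: unitary_matrix_def matrix_vector_mul_assoc)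
    then have "?u \<noteq> 0" by (metis axis_eq_0_iff matrix_vector_mult_0_right one_neq_zero)
    then have "0 < Re (cinner (A *v ?u) ?u)" using A by (simp add: pos_definite_def)
    also have "A *v ?u = U *v (real_diag d *v axis i 1)"
      by (simp only: Ad matrix_vector_mul_assoc[symmetric] e)
    also have "cinner \<dots> ?u = cinner (real_diag d *v axis i 1) (axis i 1)"
      by (simp only: cinner_matrix_left[of U] e)
    also have "\<dots> = complex_of_real (d i)"
      by (simp add: cinner_axis_axis) (simp add: real_diag_def)
    finally show ?thesis by simp
  qed
  have "matrix_pow A s = U ** real_diag (\<lambda>i. d i powr s) ** conj_transpose U" for s
    unfolding matrix_pow_def by (subst Ad) (rule fun_calculus_diagonalization[OF U])
  with U pos Ad show ?thesis by (rule that)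
qed

lemma matrix_pow_add:
  fixes A :: "complex ^ 'n ^ 'n"
  assumes "pos_definite A"
  shows "matrix_pow A s ** matrix_pow A t = matrix_pow A (s + t)"
proof -
  obtain U d where U: "unitary_matrix U" and d: "\<And>i. 0 < d i"
    and Ad: "A = U ** real_diag d ** conj_transpose U"
    and pw: "\<And>s. matrix_pow A s = U ** real_diag (\<lambda>i. d i powr s) ** conj_transpose U"
    by (fact pos_definite_diagonalization[OF assms])
  have "matrix_pow A s ** matrix_pow A t
      = U ** (real_diag (\<lambda>i. d i powr s) ** ((conj_transpose U ** U) ** real_diag (\<lambda>i. d i powr t)))
        ** conj_transpose U"
    by (simp only: pw matrix_mul_assoc)
  then show ?thesis
    using U by (simp add: unitary_matrix_def real_diag_mult powr_add pw)
qed

lemma matrix_pow_0: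
  assumes "pos_definite A"
  shows "matrix_pow A 0 = mat 1"
proof -
  obtain U d where U: "unitary_matrix U" and d: "\<And>i. 0 < d i"
    and Ad: "A = U ** real_diag d ** conj_transpose U"
    and pw: "\<And>s. matrix_pow A s = U ** real_diag (\<lambda>i. d i powr s) ** conj_transpose U"
    by (fact pos_definite_diagonalization[OF assms])
  \<comment> \<open>Positivity matters here, as \<open>0 powr 0\<close> is \<open>0\<close>.\<close>
  have "(\<lambda>i. d i powr 0) = (\<lambda>i. 1)" using d by (simp add: less_imp_neq[symmetric])
  then show ?thesis using U by (simp add: pw real_diag_1 unitary_matrix_def)
qed

lemma conj_transpose_matrix_pow:
  assumes "pos_definite A"
  shows "conj_transpose (matrix_pow A s) = matrix_pow A s"
proof -
  obtain U d where U: "unitary_matrix U" and d: "\<And>i. 0 < d i"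
    and Ad: "A = U ** real_diag d ** conj_transpose U"
    and pw: "\<And>s. matrix_pow A s = U ** real_diag (\<lambda>i. d i powr s) ** conj_transpose U"
    by (fact pos_definite_diagonalization[OF assms])
  show ?thesis by (simp add: pw conj_transpose_mult matrix_mul_assoc)
qed

lemma pos_definite_diagonal:
  assumes "pos_definite A"
  shows "A $ k $ k = complex_of_real (Re (A $ k $ k))" "0 < Re (A $ k $ k)"
proof -
  have "cnj (A $ k $ k) = A $ k $ k"
    using assms by (simp add: pos_definite_def conj_transpose_def vec_eq_iff)
  then show "A $ k $ k = complex_of_real (Re (A $ k $ k))"
    by (metis Reals_cnj_iff of_real_Re)
  have "axis k (1::complex) \<noteq> 0" by (simp add: axis_eq_0_iff)
  then show "0 < Re (A $ k $ k)"
    using assms by (metis pos_definite_def cinner_axis_axis)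
qed

lemma pos_definite_eigenvector:
  assumes A: "pos_definite A" and v: "A *v v = l *\<^sub>R v" "v \<noteq> 0"
  shows "0 < l" "matrix_pow A s *v v = (l powr s) *\<^sub>R v"
proof -
  have "0 < Re (cinner (A *v v) v)" using A v(2) by (simp add: pos_definite_def)
  then show "0 < l" using v by (simp add: cinner_scaleR_left cinner_self zero_less_mult_iff)
  obtain U d where U: "unitary_matrix U" and d: "\<And>i. 0 < d i"
    and Ad: "A = U ** real_diag d ** conj_transpose U"
    and pw: "\<And>s. matrix_pow A s = U ** real_diag (\<lambda>i. d i powr s) ** conj_transpose U"
    by (fact pos_definite_diagonalization[OF A])
  define y where "y = conj_transpose U *v v"
  have vy: "v = U *v y" using U by (simp add: y_def matrix_vector_mul_assoc unitary_matrix_def)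
  have "real_diag d *v y = (conj_transpose U ** U) *v (real_diag d *v y)"
    using U by (simp add: unitary_matrix_def)
  also have "\<dots> = conj_transpose U *v (A *v v)"
    by (simp add: Ad y_def matrix_vector_mul_assoc matrix_mul_assoc)
  also have "\<dots> = l *\<^sub>R y" by (simp add: v y_def complex_matrix_vector_mult_scaleR)
  finally have "complex_of_real (d i) * y $ i = complex_of_real l * y $ i" for i
    by (metis real_diag_vector_nth vector_smult_component scaleR_eq_vector_scalar_mult)
  \<comment> \<open>The coordinates of \<open>v\<close> in the eigenbasis live only at indices with
    \<open>d i = l\<close>, where the power acts as \<open>l powr s\<close>.\<close>
  then have "real_diag (\<lambda>i. d i powr s) *v y = (l powr s) *\<^sub>R y"
    by (auto simp: vec_eq_iff real_diag_vector_nth scaleR_eq_vector_scalar_mult)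
  then show "matrix_pow A s *v v = (l powr s) *\<^sub>R v"
    by (simp add: pw y_def[symmetric] matrix_vector_mul_assoc[symmetric] complex_matrix_vector_mult_scaleR vy[symmetric])
qed


subsection \<open>Measurability of matrix powers\<close>

text \<open>Preimages under \<open>f\<close> and \<open>g\<close> differ by a null set, and
  completeness makes such sets measurable. It is needed because \<open>matrix_pow (W x) s\<close> is
  under no control on the null set where \<open>W x\<close> fails to be positive definite.\<close>

lemma (in complete_measure) measurable_AE_cong:
  assumes f: "f \<in> M \<rightarrow>\<^sub>M N" and ae: "AE x in M. f x = g x"
    and g: "\<And>x. x \<in> space M \<Longrightarrow> g x \<in> space N"
  shows "g \<in> M \<rightarrow>\<^sub>M N"
proof (rule measurableI)
  fix B assume "B \<in> sets N"
  then have B: "f -` B \<inter> space M \<in> sets M" using f by (rule measurable_sets[rotated])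
  have "AE x in M. x \<in> f -` B \<inter> space M \<longleftrightarrow> x \<in> g -` B \<inter> space M"
    using ae by eventually_elim auto
  then show "g -` B \<inter> space M \<in> sets M" using B by (rule in_sets_AE) auto
qed (rule g)

text \<open>This gives completeness for the torus, a restriction of Lebesgue measure to a
  cube.\<close>

lemma complete_measure_restrict_space:
  assumes "complete_measure M" and S: "S \<in> sets M"
  shows "complete_measure (restrict_space M S)"
proof
  interpret complete_measure M by fact
  have S': "S \<inter> space M \<in> sets M" using S by auto
  fix A B assume "B \<subseteq> A" "A \<in> null_sets (restrict_space M S)"
  then have "A \<subseteq> S" "B \<in> null_sets M"
    using null_sets_restrict_space[OF S] complete2 by auto
  with \<open>B \<subseteq> A\<close> show "B \<in> sets (restrict_space M S)"
    using S' by (auto simp: sets_restrict_space_iff)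
qed

lemma diagonalization_nth:
  "(U ** real_diag d ** conj_transpose U) $ i $ j
    = (\<Sum>k\<in>UNIV. U $ i $ k * complex_of_real (d k) * cnj (U $ j $ k))"
  unfolding matrix_matrix_mult_def[of "U ** real_diag d"] vec_lambda_beta mult_real_diag_nth
  by (simp add: conj_transpose_def)

lemma matrix_funpow_diagonalization:
  assumes "unitary_matrix U"
  shows "(((**) (U ** real_diag d ** conj_transpose U)) ^^ k) (mat 1)
    = U ** real_diag (\<lambda>i. d i ^ k) ** conj_transpose U"
proof (induction k)
  case 0
  then show ?case using assms by (simp add: real_diag_1 unitary_matrix_def)
next
  case (Suc k)
  have "(((**) (U ** real_diag d ** conj_transpose U)) ^^ Suc k) (mat 1)
     = U ** (real_diag d ** ((conj_transpose U ** U) ** real_diag (\<lambda>i. d i ^ k))) ** conj_transpose U"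
    by (simp only: funpow.simps comp_apply Suc matrix_mul_assoc)
  then show ?case using assms by (simp add: unitary_matrix_def real_diag_mult)
qed

lemma continuous_on_matrix_funpow:
  "continuous_on UNIV (\<lambda>A :: complex ^ 'n ^ 'n. (((**) A) ^^ k) (mat 1))"
proof (induction k)
  case (Suc k)
  then show ?case
    by (auto simp: matrix_matrix_mult_def intro!: continuous_intros)
qed simp

text \<open>Weierstrass approximation on the intervals from \<open>1/(n+1)\<close> to
  \<open>n+1\<close>, with error \<open>1/(n+1)\<close>: each positive \<open>t\<close> lies in all
  but finitely many of them.\<close>

lemma powr_polynomial_approx:
  fixes s :: real
  obtains P :: "nat \<Rightarrow> real \<Rightarrow> real"
  where "\<And>n. real_polynomial_function (P n)" "\<And>t. 0 < t \<Longrightarrow> (\<lambda>n. P n t) \<longlonglongrightarrow> t powr s"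
proof -
  have "\<exists>g. real_polynomial_function g \<and>
      (\<forall>t\<in>{inverse (real (Suc n)) .. real (Suc n)}. \<bar>t powr s - g t\<bar> < inverse (real (Suc n)))" for n
  proof -
    have pos: "inverse (real (Suc n)) > 0" by simp
    have "continuous_on {inverse (real (Suc n)) .. real (Suc n)} (\<lambda>t. t powr s)"
      using pos by (intro continuous_intros) (auto simp del: inverse_Suc)
    then show ?thesis
      using Stone_Weierstrass_real_polynomial_function[OF compact_Icc _ pos] by metis
  qed
  then obtain P where P: "\<And>n. real_polynomial_function (P n)"
    and b: "\<And>n t. t \<in> {inverse (real (Suc n)) .. real (Suc n)} \<Longrightarrow> \<bar>t powr s - P n t\<bar> < inverse (real (Suc n))"
    by metis
  have "(\<lambda>n. P n t) \<longlonglongrightarrow> t powr s" if t: "0 < t" for t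
  proof -
    have "\<forall>\<^sub>F n in sequentially. inverse (real (Suc n)) < t"
      using LIMSEQ_inverse_real_of_nat t by (rule order_tendstoD)
    moreover have "\<forall>\<^sub>F n in sequentially. t \<le> real n"
      using filterlim_real_sequentially by (simp add: filterlim_at_top)
    ultimately have "\<forall>\<^sub>F n in sequentially. norm (P n t - t powr s) \<le> inverse (real (Suc n))"
    proof eventually_elim
      case (elim n)
      then show ?case using b[of t n] by (simp add: abs_minus_commute)
    qed
    then have "(\<lambda>n. P n t - t powr s) \<longlonglongrightarrow> 0"
      using LIMSEQ_inverse_real_of_nat by (rule Lim_null_comparison)
    then show ?thesis by (rule LIM_zero_cancel)
  qed
  with P show ?thesis by (rule that)
qed

text \<open>On positive definite matrices the power is a pointwise limit of polynomials in the matrix,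
  namely of those approximating \<open>t powr s\<close> on \<open>(0, \<infinity>)\<close>.\<close>

lemma borel_measurable_matrix_pow:
  fixes W :: "'a \<Rightarrow> complex ^ 'n ^ 'n"
  assumes "complete_measure M" and W: "matrix_weight M W"
  shows "(\<lambda>x. matrix_pow (W x) s) \<in> borel_measurable M"
proof -
  interpret complete_measure M by fact
  obtain P :: "nat \<Rightarrow> real \<Rightarrow> real" where P: "\<And>n. real_polynomial_function (P n)"
    and lim: "\<And>t. 0 < t \<Longrightarrow> (\<lambda>n. P n t) \<longlonglongrightarrow> t powr s"
    by (fact powr_polynomial_approx)
  \<comment> \<open>Explicit coefficients allow the same polynomial to be evaluated at a
    matrix.\<close>
  obtain a N where Pa: "\<And>n. P n = (\<lambda>t. \<Sum>k\<le>N n. a n k * t ^ k)"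
    using P unfolding real_polynomial_function_iff_sum by metis
  define Q :: "nat \<Rightarrow> complex ^ 'n ^ 'n \<Rightarrow> complex ^ 'n ^ 'n"
    where "Q n A = (\<Sum>k\<le>N n. a n k *\<^sub>R (((**) A) ^^ k) (mat 1))" for n A
  have "continuous_on UNIV (Q n)" for n
    unfolding Q_def by (intro continuous_intros continuous_on_matrix_funpow)
  moreover have "W \<in> borel_measurable M" using W by (simp add: matrix_weight_def)
  ultimately have "(\<lambda>x. Q n (W x)) \<in> borel_measurable M" for n
    by (auto intro: measurable_compose borel_measurable_continuous_onI)
  then have "(\<lambda>x. lim (\<lambda>n. Q n (W x))) \<in> borel_measurable M"
    by (rule borel_measurable_lim_metric)
  moreover have "lim (\<lambda>n. Q n A) = matrix_pow A s" if pd: "pos_definite A" for A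
  proof (rule limI)
    obtain U d where U: "unitary_matrix U" and d: "\<And>i. 0 < d i"
      and Ad: "A = U ** real_diag d ** conj_transpose U"
      and pw: "\<And>s. matrix_pow A s = U ** real_diag (\<lambda>i. d i powr s) ** conj_transpose U"
      by (fact pos_definite_diagonalization[OF pd])
    \<comment> \<open>A polynomial acts on the eigenvalues alone, so convergence is only needed at
      the positive numbers \<open>d i\<close>.\<close>
    have Q: "Q n A = U ** real_diag (\<lambda>i. P n (d i)) ** conj_transpose U" for n
    proof -
      have "Q n A $ i $ j = (\<Sum>k\<le>N n. \<Sum>l\<in>UNIV. U $ i $ l * complex_of_real (a n k * d l ^ k) * cnj (U $ j $ l))"
        for i j
        unfolding Q_def sum_component vector_scaleR_component Ad matrix_funpow_diagonalization[OF U]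
          diagonalization_nth
        by (simp add: scaleR_conv_of_real sum_distrib_left mult_ac)
      also have "\<dots> i j = (U ** real_diag (\<lambda>i. P n (d i)) ** conj_transpose U) $ i $ j" for i j
        unfolding diagonalization_nth Pa
        by (subst sum.swap) (simp add: sum_distrib_left sum_distrib_right)
      finally show ?thesis by (simp add: vec_eq_iff)
    qed
    show "(\<lambda>n. Q n A) \<longlonglongrightarrow> matrix_pow A s"
      unfolding Q pw
      by (intro vec_tendstoI) (simp add: diagonalization_nth, intro tendsto_intros lim d)
  qed
  then have "AE x in M. lim (\<lambda>n. Q n (W x)) = matrix_pow (W x) s"
    using W unfolding matrix_weight_def by auto
  ultimately show ?thesis by (rule measurable_AE_cong) simp
qed

lemma borel_measurable_matrix_vector_mult:
  fixes F :: "'a \<Rightarrow> complex ^ 'n ^ 'm"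
  assumes "F \<in> borel_measurable M" "f \<in> borel_measurable M"
  shows "(\<lambda>x. F x *v f x) \<in> borel_measurable M"
  using assms
  by (rule borel_measurable_continuous_Pair)
    (simp add: matrix_vector_mult_def, intro continuous_intros)

lemma borel_measurable_cinner:
  fixes f g :: "'a \<Rightarrow> complex ^ 'n"
  assumes "f \<in> borel_measurable M" "g \<in> borel_measurable M"
  shows "(\<lambda>x. cinner (f x) (g x)) \<in> borel_measurable M"
  using assms
  by (rule borel_measurable_continuous_Pair) (simp add: cinner_def, intro continuous_intros)

lemma cinner_matrix_pow:
  assumes "pos_definite A"
  shows "cinner (matrix_pow A s *v x) (matrix_pow A t *v y) = cinner (matrix_pow A (s + t) *v x) y"
proof -
  have "cinner (matrix_pow A s *v x) (matrix_pow A t *v y) = cinner (matrix_pow A t *v (matrix_pow A s *v x)) y"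
    by (simp add: cinner_matrix_left[of "matrix_pow A t"] conj_transpose_matrix_pow[OF assms])
  then show ?thesis
    by (simp add: matrix_vector_mul_assoc matrix_pow_add[OF assms] add.commute)
qed

text \<open>Inserting \<open>A\<close> to the powers \<open>s\<close> and \<open>-s\<close>, which
  are Hermitian and mutually inverse, leaves the inner product unchanged; then Cauchy-Schwarz
  applies.\<close>

lemma norm_cinner_le_matrix_pow:
  assumes "pos_definite A"
  shows "norm (cinner x y) \<le> norm (matrix_pow A s *v x) * norm (matrix_pow A (- s) *v y)"
  using norm_cinner_le[of "matrix_pow A s *v x" "matrix_pow A (- s) *v y"]
  by (simp add: cinner_matrix_pow[OF assms] matrix_pow_0[OF assms])


subsection \<open>Bounded projections\<close>

text \<open>Raising to the power \<open>p\<close> is monotone on nonnegative reals. This passes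
  between the essential bound in the theorem and the form in which the weight enters the
  integrands.\<close>

lemma powr_bound_iff:
  fixes a b C p :: real
  assumes p: "0 < p" and "0 \<le> a" "0 \<le> b" "0 \<le> C"
  shows "a powr (1 / p) * b \<le> C \<longleftrightarrow> b powr p * a \<le> C powr p"
proof -
  have "(a powr (1 / p) * b) powr p = b powr p * a"
    using assms by (simp add: powr_mult powr_powr)
  then show ?thesis
    using assms
    by (smt (verit) mult_nonneg_nonneg powr_ge_zero powr_mono2 powr_less_mono2)
qed

lemma powr_Lp_bound_iff:
  fixes I J C p :: real
  assumes p: "0 < p" and "0 \<le> I" "0 \<le> J" "0 \<le> C"
  shows "I powr (1 / p) \<le> C * J powr (1 / p) \<longleftrightarrow> I \<le> C powr p * J"
proof -
  have "(I powr (1 / p)) powr p = I" "(C * J powr (1 / p)) powr p = C powr p * J"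
    using assms by (simp_all add: powr_mult powr_powr)
  then show ?thesis
    using assms
    by (smt (verit) mult_nonneg_nonneg powr_ge_zero powr_mono2 powr_less_mono2)
qed

text \<open>On a part of the set where \<open>h\<close> exceeds \<open>K\<close>, the integral of
  \<open>h - K\<close> is at most zero although the integrand is positive, so that part is null.
  Requiring the hypothesis only for such parts lets a test function divide by a quantity that is
  positive there.\<close>

lemma AE_le_of_set_integral_le:
  fixes h :: "'a \<Rightarrow> real"
  assumes "sigma_finite_measure M" and h [measurable]: "h \<in> borel_measurable M"
    and le: "\<And>E. E \<in> fmeasurable M \<Longrightarrow> \<forall>x\<in>E. K < h x \<Longrightarrow>
      integrable M (\<lambda>x. indicator E x * h x) \<and> (\<integral>x. indicator E x * h x \<partial>M) \<le> K * measure M E"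
  shows "AE x in M. h x \<le> K"
proof -
  interpret sigma_finite_measure M by fact
  obtain A :: "nat \<Rightarrow> 'a set"
    where A: "range A \<subseteq> sets M" "(\<Union>i. A i) = space M" "\<And>i. emeasure M (A i) \<noteq> \<infinity>"
    by (fact sigma_finite)
  have [measurable]: "A i \<in> sets M" for i using A(1) by auto
  \<comment> \<open>Cutting with the exhausting sets \<open>A i\<close> gives finite measure, so
    that the constant \<open>K\<close> is integrable over \<open>E i\<close>.\<close>
  define E where "E i = {x \<in> space M. x \<in> A i \<and> K < h x}" for i
  have Em [measurable]: "E i \<in> sets M" for i unfolding E_def by measurable
  have fE: "E i \<in> fmeasurable M" for i
  proof (rule fmeasurableI2)
    show "A i \<in> fmeasurable M" using A(3)[of i] by (simp add: fmeasurable_def top.not_eq_extremum)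
  qed (auto simp: E_def)
  have "AE x in M. x \<notin> E i" for i
  proof -
    have *: "integrable M (\<lambda>x. indicator (E i) x * h x)"
      "(\<integral>x. indicator (E i) x * h x \<partial>M) \<le> K * measure M (E i)"
      using le[OF fE, of i] by (auto simp: E_def)
    have i: "integrable M (\<lambda>x. indicator (E i) x * K)"
      using fE[of i] by (intro integrable_mult_left) (simp add: fmeasurable_def)
    have int: "integrable M (\<lambda>x. indicator (E i) x * h x - indicator (E i) x * K)"
      using *(1) i by (rule Bochner_Integration.integrable_diff)
    have nn: "AE x in M. 0 \<le> indicator (E i) x * h x - indicator (E i) x * K"
      by (auto simp: E_def indicator_def)
    have "(\<integral>x. indicator (E i) x * h x - indicator (E i) x * K \<partial>M) \<le> 0"
      unfolding Bochner_Integration.integral_diff[OF *(1) i] using *(2) by (simp add: mult.commute)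
    then have "(\<integral>x. indicator (E i) x * h x - indicator (E i) x * K \<partial>M) = 0"
      using integral_nonneg_AE[OF nn] by simp
    then have "AE x in M. indicator (E i) x * h x - indicator (E i) x * K = 0"
      using integral_nonneg_eq_0_iff_AE[OF int nn] by simp
    then show ?thesis by eventually_elim (auto simp: E_def indicator_def split: if_splits)
  qed
  then have "AE x in M. \<forall>i. x \<notin> E i" by (simp add: AE_all_countable)
  then show ?thesis
    using AE_space by eventually_elim (use A(2) in \<open>force simp: E_def\<close>)
qed

text \<open>For necessity, test the operator on \<open>f = 1\<^sub>E W\<^bsup>-2/p\<^esup> r / |W\<^bsup>-1/p\<^esup> r|\<close>: then
  \<open>|W\<^bsup>1/p\<^esup> f| = 1\<^sub>E\<close> while \<open>\<langle>f, r\<rangle> = 1\<^sub>E |W\<^bsup>-1/p\<^esup> r|\<close>.\<close>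

lemma bounded_Lp_proj_iff:
  fixes W :: "'a \<Rightarrow> complex ^ 'n ^ 'n" and p :: real
  assumes p: "0 < p" and M: "complete_measure M" "sigma_finite_measure M"
    and W: "matrix_weight M W" and w: "scalar_weight M w" and r: "r \<in> borel_measurable M"
  shows "bounded_Lp M p W w (proj r) \<longleftrightarrow>
    (\<exists>C. AE x in M. Re (w x) powr (1 / p) * norm (matrix_pow (W x) (- (1 / p)) *v r x) \<le> C)"
proof -
  define n where "n x = norm (matrix_pow (W x) (- (1 / p)) *v r x)" for x
  have pw [measurable]: "(\<lambda>x. matrix_pow (W x) s) \<in> borel_measurable M" for s
    using M(1) W by (rule borel_measurable_matrix_pow)
  have n_meas [measurable]: "n \<in> borel_measurable M"
    unfolding n_def by (intro measurable_compose[OF _ borel_measurable_norm] borel_measurable_matrix_vector_mult pw r)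
  have w_meas [measurable]: "w \<in> borel_measurable M" using w by (simp add: scalar_weight_def)
  have [measurable]: "(\<lambda>x. Re (w x)) \<in> borel_measurable M"
    by measurable
  have pd: "AE x in M. pos_definite (W x)" using W by (simp add: matrix_weight_def)
  have wp: "AE x in M. 0 < Re (w x)" using w by (auto simp: scalar_weight_def)
  have n0: "0 \<le> n x" for x by (simp add: n_def)
  show ?thesis unfolding n_def[symmetric]
  proof
    assume "\<exists>C. AE x in M. Re (w x) powr (1 / p) * n x \<le> C"
    then obtain C0 where C0: "AE x in M. Re (w x) powr (1 / p) * n x \<le> C0" ..
    \<comment> \<open>The equivalences for p-th powers need a nonnegative constant.\<close>
    define C where "C = max C0 0"
    have C: "0 \<le> C" by (simp add: C_def)
    have bd: "AE x in M. n x powr p * Re (w x) \<le> C powr p"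
      using C0 wp
    proof eventually_elim
      case (elim x)
      then have "Re (w x) powr (1 / p) * n x \<le> C" by (simp add: C_def)
      then show ?case using powr_bound_iff[OF p _ n0 C] elim by simp
    qed
    show "bounded_Lp M p W w (proj r)"
      unfolding bounded_Lp_def
    proof (intro exI ballI conjI)
      fix f assume f: "f \<in> matrix_Lp M p W"
      let ?F = "\<lambda>x. norm (matrix_pow (W x) (1 / p) *v f x) powr p"
      let ?G = "\<lambda>x. norm (proj r f x) powr p * Re (w x)"
      have fm: "f \<in> borel_measurable M" and F: "integrable M ?F"
        using f by (simp_all add: matrix_Lp_def)
      have pm [measurable]: "proj r f \<in> borel_measurable M"
        unfolding proj_def by (rule borel_measurable_cinner[OF fm r])
      have le: "AE x in M. ?G x \<le> C powr p * ?F x"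
        using bd pd wp
      proof eventually_elim
        case (elim x)
        let ?a = "norm (matrix_pow (W x) (1 / p) *v f x)"
        have "norm (proj r f x) \<le> ?a * n x"
          unfolding proj_def n_def by (rule norm_cinner_le_matrix_pow[OF elim(2)])
        then have "norm (proj r f x) powr p \<le> ?a powr p * n x powr p"
          using p by (metis less_imp_le norm_ge_zero powr_mono2 powr_mult)
        then have "?G x \<le> ?a powr p * n x powr p * Re (w x)"
          using elim(3) by (simp add: mult_right_mono)
        also have "\<dots> \<le> ?a powr p * C powr p"
          using elim(1) by (simp only: mult.assoc) (rule mult_left_mono, auto)
        finally show ?case by (simp add: mult.commute)
      qed
      have Gnn: "AE x in M. 0 \<le> ?G x" using wp by eventually_elim simp
      \<comment> \<open>Integrability is a separate claim: the Bochner integral of a non-integrable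
        function is \<open>0\<close>, so the norm inequality alone would not give it.\<close>
      have G: "integrable M ?G"
      proof (rule Bochner_Integration.integrable_bound)
        show "integrable M (\<lambda>x. C powr p * ?F x)" using F by simp
        show "?G \<in> borel_measurable M" by measurable
        show "AE x in M. norm (?G x) \<le> norm (C powr p * ?F x)"
          using le Gnn by eventually_elim simp
      qed
      show "proj r f \<in> scalar_Lp M p w" using G pm by (simp add: scalar_Lp_def)
      have "(\<integral>x. ?G x \<partial>M) \<le> (\<integral>x. C powr p * ?F x \<partial>M)"
        using G F le by (intro integral_mono_AE) auto
      then have "(\<integral>x. ?G x \<partial>M) \<le> C powr p * (\<integral>x. ?F x \<partial>M)" by simp
      moreover have "0 \<le> (\<integral>x. ?G x \<partial>M)" using Gnn by (rule integral_nonneg_AE)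
      moreover have "0 \<le> (\<integral>x. ?F x \<partial>M)" by (rule integral_nonneg_AE) simp
      ultimately show "scalar_Lp_norm M p w (proj r f) \<le> C * matrix_Lp_norm M p W f"
        unfolding scalar_Lp_norm_def matrix_Lp_norm_def
        by (subst powr_Lp_bound_iff[OF p _ _ C]) auto
    qed
  next
    assume "bounded_Lp M p W w (proj r)"
    then obtain C0 where C0: "\<And>f. f \<in> matrix_Lp M p W \<Longrightarrow> proj r f \<in> scalar_Lp M p w"
      "\<And>f. f \<in> matrix_Lp M p W \<Longrightarrow> scalar_Lp_norm M p w (proj r f) \<le> C0 * matrix_Lp_norm M p W f"
      unfolding bounded_Lp_def by blast
    define C where "C = max C0 0"
    have C: "0 \<le> C" by (simp add: C_def)
    have "AE x in M. n x powr p * Re (w x) \<le> C powr p"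
    proof (rule AE_le_of_set_integral_le[OF M(2)])
      fix E assume E: "E \<in> fmeasurable M" and big: "\<forall>x\<in>E. C powr p < n x powr p * Re (w x)"
      have [measurable]: "E \<in> sets M" using E by (rule fmeasurableD)
      \<comment> \<open>If \<open>n x = 0\<close>, then \<open>n x powr p * Re (w x)\<close> is
        \<open>0\<close> and cannot exceed \<open>C powr p\<close>.\<close>
      have npos: "0 < n x" if "x \<in> E" for x
        using big that n0[of x] p by (cases "n x = 0") (auto simp: not_less dest!: bspec)
      define f where "f x = (indicator E x / n x) *\<^sub>R (matrix_pow (W x) (- (2 / p)) *v r x)" for x
      have fm: "f \<in> borel_measurable M"
        unfolding f_def
        by (intro borel_measurable_scaleR borel_measurable_matrix_vector_mult pw r) measurable
      let ?F = "\<lambda>x. norm (matrix_pow (W x) (1 / p) *v f x) powr p"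
      let ?G = "\<lambda>x. norm (proj r f x) powr p * Re (w x)"
      \<comment> \<open>Dividing by \<open>n x\<close> normalizes the vector on \<open>E\<close>;
        off \<open>E\<close> the test function is zero and \<open>0 powr p\<close> is
        \<open>0\<close>.\<close>
      have F: "AE x in M. ?F x = indicator E x"
        using pd
      proof eventually_elim
        case (elim x)
        have "matrix_pow (W x) (1 / p) *v (matrix_pow (W x) (- (2 / p)) *v r x)
            = matrix_pow (W x) (- (1 / p)) *v r x"
          by (simp add: matrix_vector_mul_assoc matrix_pow_add[OF elim] add_divide_distrib[symmetric] diff_divide_distrib[symmetric])
        then have "norm (matrix_pow (W x) (1 / p) *v f x) = \<bar>indicator E x / n x\<bar> * n x"
          by (simp add: f_def complex_matrix_vector_mult_scaleR n_def)
        then show ?case using npos[of x] p by (auto simp: indicator_def)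
      qed
      have G: "AE x in M. ?G x = indicator E x * (n x powr p * Re (w x))"
        using pd
      proof eventually_elim
        case (elim x)
        have "cinner (matrix_pow (W x) (- (2 / p)) *v r x) (r x) = complex_of_real ((n x)\<^sup>2)"
          unfolding n_def cinner_self[symmetric] cinner_matrix_pow[OF elim] by simp
        then have "proj r f x = complex_of_real (indicator E x / n x * (n x)\<^sup>2)"
          by (simp add: proj_def f_def cinner_scaleR_left)
        then have "norm (proj r f x) = indicator E x * n x"
          using n0[of x] by (simp only: norm_of_real) (auto simp: indicator_def power2_eq_square)
        then show ?case by (auto simp: indicator_def)
      qed
      have IE: "integrable M (indicator E :: 'a \<Rightarrow> real)"
        using E by (simp add: fmeasurable_def)
      have [measurable]: "(\<lambda>x. matrix_pow (W x) (1 / p) *v f x) \<in> borel_measurable M"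
        by (rule borel_measurable_matrix_vector_mult[OF pw fm])
      have Fm: "?F \<in> borel_measurable M" by measurable
      have fLp: "f \<in> matrix_Lp M p W"
        using integrable_cong_AE[OF Fm _ F] IE fm by (simp add: matrix_Lp_def)
      have pm [measurable]: "proj r f \<in> borel_measurable M"
        unfolding proj_def by (rule borel_measurable_cinner[OF fm r])
      \<comment> \<open>Boundedness includes membership of the image in the target space, which
        supplies the integrability over \<open>E\<close>.\<close>
      have Gi: "integrable M ?G" using C0(1)[OF fLp] by (simp add: scalar_Lp_def)
      have int: "integrable M (\<lambda>x. indicator E x * (n x powr p * Re (w x)))"
        using integrable_cong_AE[OF _ _ G] Gi by simp
      have "(\<integral>x. ?G x \<partial>M) = (\<integral>x. indicator E x * (n x powr p * Re (w x)) \<partial>M)"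
        using G by (intro integral_cong_AE) measurable
      moreover have "(\<integral>x. ?F x \<partial>M) = measure M E"
        using integral_cong_AE[OF Fm _ F] by simp
      moreover have "0 \<le> (\<integral>x. ?G x \<partial>M)"
        using wp by (intro integral_nonneg_AE) (auto elim: eventually_mono)
      moreover have "(\<integral>x. ?G x \<partial>M) powr (1 / p) \<le> C * (\<integral>x. ?F x \<partial>M) powr (1 / p)"
        using C0(2)[OF fLp] unfolding scalar_Lp_norm_def matrix_Lp_norm_def C_def
        by (rule order_trans) (auto intro: mult_right_mono)
      ultimately have "(\<integral>x. indicator E x * (n x powr p * Re (w x)) \<partial>M) \<le> C powr p * measure M E"
        using powr_Lp_bound_iff[OF p _ _ C] by simp
      with int show "integrable M (\<lambda>x. indicator E x * (n x powr p * Re (w x))) \<and>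
          (\<integral>x. indicator E x * (n x powr p * Re (w x)) \<partial>M) \<le> C powr p * measure M E" ..
    qed measurable
    then have "AE x in M. Re (w x) powr (1 / p) * n x \<le> C"
      using wp by eventually_elim (simp add: powr_bound_iff[OF p _ n0 C])
    then show "\<exists>C. AE x in M. Re (w x) powr (1 / p) * n x \<le> C" ..
  qed
qed

text \<open>The functions in the theorem are complex valued and real only almost everywhere;
  completeness transfers measurability from the real representative \<open>g\<close>.\<close>

lemma Linfty_iff_AE:
  assumes "complete_measure M" and g: "g \<in> borel_measurable M" and ae: "AE x in M. f x = complex_of_real (g x)"
  shows "f \<in> Linfty M \<longleftrightarrow> (\<exists>C. AE x in M. \<bar>g x\<bar> \<le> C)"
proof -
  interpret complete_measure M by fact
  have "(\<lambda>x. complex_of_real (g x)) \<in> borel_measurable M" using g by simp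
  moreover have "AE x in M. complex_of_real (g x) = f x" using ae by eventually_elim simp
  ultimately have "f \<in> borel_measurable M" by (rule measurable_AE_cong) simp
  moreover have "(AE x in M. norm (f x) \<le> C) \<longleftrightarrow> (AE x in M. \<bar>g x\<bar> \<le> C)" for C
    by (rule eventually_subst) (use ae in \<open>eventually_elim, simp\<close>)
  ultimately show ?thesis by (simp add: Linfty_def)
qed

theorem theorem3p1:
  fixes p :: real
    and D :: "'a::euclidean_space measure"
    and W :: "'a \<Rightarrow> complex ^ 'n ^ 'n"
  assumes "1 < p"
    and "D = lebesgue \<or> D = torus"
    and "matrix_weight D W"
  shows "(\<forall>w r. scalar_weight D w \<longrightarrow> r \<in> borel_measurable D \<longrightarrow> (\<forall>x\<in>space D. norm (r x) = 1) \<longrightarrow>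
            (bounded_Lp D p W w (proj r) \<longleftrightarrow>
             (\<lambda>x. w x powr complex_of_real (1 / p)
                  * complex_of_real (norm (matrix_pow (W x) (- (1 / p)) *v r x))) \<in> Linfty D))
       \<and> (\<forall>k. bounded_Lp D p W (\<lambda>x. W x $ k $ k) (proj (\<lambda>x. axis k 1)) \<longleftrightarrow>
             (\<lambda>x. (W x $ k $ k) powr complex_of_real (2 / p)
                  * matrix_pow (W x) (- (2 / p)) $ k $ k) \<in> Linfty D)
       \<and> (\<forall>(lam :: 'a \<Rightarrow> real) v. lam \<in> borel_measurable D \<longrightarrow> v \<in> borel_measurable D \<longrightarrow>
             (AE x in D. W x *v v x = lam x *\<^sub>R v x \<and> norm (v x) = 1) \<longrightarrow>
             bounded_Lp D p W (\<lambda>x. complex_of_real (lam x)) (proj v))"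
proof (intro conjI allI impI)
  let ?Q = "{x :: 'a. \<forall>b\<in>Basis. 0 \<le> x \<bullet> b \<and> x \<bullet> b < 1}"
  have "?Q = (\<Inter>b\<in>Basis. {x. 0 \<le> x \<bullet> b} \<inter> {x. x \<bullet> b < 1})" by auto
  also have "\<dots> \<in> sets lborel"
    by (intro sets.finite_INT) auto
  finally have Q: "?Q \<in> sets lebesgue" by simp
  \<comment> \<open>A countable Borel cover by sets of finite measure keeps these measures under
    completion.\<close>
  have sf: "sigma_finite_measure (lebesgue :: 'a measure)"
  proof
    show "\<exists>A::'a set set. countable A \<and> A \<subseteq> sets lebesgue \<and> \<Union>A = space lebesgue \<and> (\<forall>a\<in>A. emeasure lebesgue a \<noteq> \<infinity>)"
      using lborel.sigma_finite_countable by (fastforce simp: emeasure_completion)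
  qed
  have D: "complete_measure D" "sigma_finite_measure D"
    using assms(2) sf complete_measure_restrict_space[OF completion.complete_measure_axioms Q]
      sigma_finite_measure_restrict_space[OF sf Q]
    by (auto simp: torus_def completion.complete_measure_axioms)
  have p: "0 < p" using assms(1) by simp
  note W = assms(3)
  have Wm: "W \<in> borel_measurable D" and pd: "AE x in D. pos_definite (W x)"
    using W by (simp_all add: matrix_weight_def)
  note iff = bounded_Lp_proj_iff[OF p D W]
  have nm: "(\<lambda>x. norm (matrix_pow (W x) s *v r x)) \<in> borel_measurable D"
    if "r \<in> borel_measurable D" for r s
    by (intro measurable_compose[OF _ borel_measurable_norm] borel_measurable_matrix_vector_mult that
        borel_measurable_matrix_pow[OF D(1) W])
  \<comment> \<open>At positive reals the complex power reduces to the real one.\<close>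
  have powr_eq: "z powr complex_of_real s = complex_of_real (Re z powr s)" if "Im z = 0" "0 < Re z" for z s
    using powr_of_real[of "Re z" s] that by (simp add: complex_eq_iff[of z "complex_of_real (Re z)"] complex_is_Real_iff)
  {
    fix w and r :: "'a \<Rightarrow> complex ^ 'n"
    assume w: "scalar_weight D w" and r: "r \<in> borel_measurable D"
    let ?n = "\<lambda>x. norm (matrix_pow (W x) (- (1 / p)) *v r x)"
    have wm: "w \<in> borel_measurable D" and wp: "AE x in D. Im (w x) = 0 \<and> 0 < Re (w x)"
      using w by (simp_all add: scalar_weight_def)
    have "(\<lambda>x. Re (w x) powr (1 / p) * ?n x) \<in> borel_measurable D"
      using wm by (intro borel_measurable_times nm r) measurable
    moreover have "AE x in D. w x powr complex_of_real (1 / p) * complex_of_real (?n x)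
        = complex_of_real (Re (w x) powr (1 / p) * ?n x)"
      using wp by eventually_elim (simp only: powr_eq of_real_mult)
    ultimately have "(\<lambda>x. w x powr complex_of_real (1 / p) * complex_of_real (?n x)) \<in> Linfty D
        \<longleftrightarrow> (\<exists>C. AE x in D. \<bar>Re (w x) powr (1 / p) * ?n x\<bar> \<le> C)"
      by (rule Linfty_iff_AE[OF D(1)])
    then show "bounded_Lp D p W w (proj r) \<longleftrightarrow>
        (\<lambda>x. w x powr complex_of_real (1 / p) * complex_of_real (?n x)) \<in> Linfty D"
      by (simp add: iff[OF w r] abs_mult)
  }
  {
    fix k
    let ?u = "\<lambda>x. Re (W x $ k $ k)"
    let ?n = "\<lambda>x. norm (matrix_pow (W x) (- (1 / p)) *v axis k 1)"
    let ?h = "\<lambda>x. ?u x powr (1 / p) * ?n x"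
    have Wk: "(\<lambda>x. W x $ k $ k) \<in> borel_measurable D"
      using Wm by (rule measurable_compose) (intro borel_measurable_continuous_onI continuous_intros)
    have diag: "AE x in D. W x $ k $ k = complex_of_real (?u x) \<and> 0 < ?u x"
      using pd by eventually_elim (use pos_definite_diagonal in blast)
    then have w: "scalar_weight D (\<lambda>x. W x $ k $ k)"
      using Wk unfolding scalar_weight_def by (auto elim!: eventually_mono simp: complex_eq_iff)
    have "?h \<in> borel_measurable D"
      using Wk by (intro borel_measurable_times nm borel_measurable_const) measurable
    then have "(\<lambda>x. (?h x)\<^sup>2) \<in> borel_measurable D" by (rule borel_measurable_power)
    moreover have "AE x in D. (W x $ k $ k) powr complex_of_real (2 / p) * matrix_pow (W x) (- (2 / p)) $ k $ k
        = complex_of_real ((?h x)\<^sup>2)"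
      using pd diag
    proof eventually_elim
      case (elim x)
      have "matrix_pow (W x) (- (2 / p)) $ k $ k = complex_of_real ((?n x)\<^sup>2)"
        unfolding cinner_self[symmetric] cinner_matrix_pow[OF elim(1)]
        by (simp add: cinner_axis_axis)
      moreover have "(W x $ k $ k) powr complex_of_real (2 / p) = complex_of_real (?u x powr (2 / p))"
        using elim(2) by (intro powr_eq) (auto simp: complex_eq_iff)
      moreover have "(?u x powr (1 / p))\<^sup>2 = ?u x powr (2 / p)"
        by (simp add: power2_eq_square powr_add[symmetric])
      ultimately show ?case by (simp only: power_mult_distrib of_real_mult)
    qed
    ultimately have "(\<lambda>x. (W x $ k $ k) powr complex_of_real (2 / p) * matrix_pow (W x) (- (2 / p)) $ k $ k) \<in> Linfty D
        \<longleftrightarrow> (\<exists>C. AE x in D. \<bar>(?h x)\<^sup>2\<bar> \<le> C)"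
      by (rule Linfty_iff_AE[OF D(1)])
    \<comment> \<open>The expression in (a) is the square of the one in the general criterion, and a
      nonnegative function is essentially bounded exactly when its square is.\<close>
    also have "\<dots> \<longleftrightarrow> (\<exists>C. AE x in D. ?h x \<le> C)"
    proof
      assume "\<exists>C. AE x in D. \<bar>(?h x)\<^sup>2\<bar> \<le> C"
      then obtain C where "AE x in D. \<bar>(?h x)\<^sup>2\<bar> \<le> C" ..
      then have "AE x in D. ?h x \<le> sqrt C"
        by eventually_elim (intro real_le_rsqrt, simp)
      then show "\<exists>C. AE x in D. ?h x \<le> C" ..
    next
      assume "\<exists>C. AE x in D. ?h x \<le> C"
      then obtain C where "AE x in D. ?h x \<le> C" ..
      then have "AE x in D. \<bar>(?h x)\<^sup>2\<bar> \<le> C\<^sup>2"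
        by eventually_elim (simp only: abs_power2, rule power_mono, auto)
      then show "\<exists>C. AE x in D. \<bar>(?h x)\<^sup>2\<bar> \<le> C" ..
    qed
    finally show "bounded_Lp D p W (\<lambda>x. W x $ k $ k) (proj (\<lambda>x. axis k 1)) \<longleftrightarrow>
        (\<lambda>x. (W x $ k $ k) powr complex_of_real (2 / p) * matrix_pow (W x) (- (2 / p)) $ k $ k) \<in> Linfty D"
      by (simp add: iff[OF w])
  }
  {
    fix lam :: "'a \<Rightarrow> real" and v
    assume lam: "lam \<in> borel_measurable D" and v: "v \<in> borel_measurable D"
      and ev: "AE x in D. W x *v v x = lam x *\<^sub>R v x \<and> norm (v x) = 1"
    \<comment> \<open>That \<open>lam\<close> is a weight follows from positive definiteness of
      \<open>W\<close>.\<close>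
    have pos: "AE x in D. 0 < lam x"
      using pd ev
    proof eventually_elim
      case (elim x)
      then show ?case using pos_definite_eigenvector(1)[of "W x" "v x" "lam x"] by force
    qed
    then have w: "scalar_weight D (\<lambda>x. complex_of_real (lam x))"
      using lam by (simp add: scalar_weight_def)
    \<comment> \<open>The unit vector \<open>v x\<close> is an eigenvector of the power
      \<open>-1/p\<close> with eigenvalue \<open>lam x powr (- (1 / p))\<close>, which cancels the
      weight factor; hence the constant 1.\<close>
    have "AE x in D. Re (complex_of_real (lam x)) powr (1 / p) * norm (matrix_pow (W x) (- (1 / p)) *v v x) \<le> 1"
      using pd ev pos
    proof eventually_elim
      case (elim x)
      then have "matrix_pow (W x) (- (1 / p)) *v v x = (lam x powr (- (1 / p))) *\<^sub>R v x"
        by (intro pos_definite_eigenvector(2)) auto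
      then show ?case using elim by (simp add: powr_add[symmetric])
    qed
    then show "bounded_Lp D p W (\<lambda>x. complex_of_real (lam x)) (proj v)"
      unfolding iff[OF w v] ..
  }
qed

end
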